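(* As power series in $q$, $$\sum_{n=0}^{\infty}\sigma_{ed}\mathrm{moex}(n)\,q^n=\frac{(q^2;q^2)^2_{\infty}\,(q;q)^3_{\infty}}{(q^4;q^4)_{\infty}}$$ and $$\sum_{n=0}^{\infty}\sigma_{ed}\mathrm{meex}(n)\,q^n=2\,\frac{(-q^2;q^2)_{\infty}}{(q;q^2)_{\infty}}\,\sigma(q^2),$$ where $\sigma(q):=\sum_{n=0}^{\infty}\frac{q^{n(n+1)/2}}{(-q;q)_n}$.
   Context: Notation: $(a;q)_0:=1$, $(a;q)_n:=\prod_{k=0}^{n-1}(1-aq^k)$, $(a;q)_\infty:=\lim_{n\to\infty}(a;q)_n$. For $n\ge 0$, $\mathcal{P}_{ed}(n)$ is the set of all partitions of $n$ in which no even part is repeated (each even part appears at most once; odd parts may appear with any multiplicity). The empty partition is the unique element of $\mathcal{P}_{ed}(0)$. For $\lambda\in\mathcal{P}_{ed}(n)$, $\mathrm{moex}_{ed}(\lambda)$ (resp. $\mathrm{meex}_{ed}(\lambda)$) is the smallest positive odd (resp. positive even) integer that is not a part of $\lambda$. Define $$\sigma_{ed}\mathrm{moex}(n):=\sum_{\lambda\in\mathcal{P}_{ed}(n)}\mathrm{moex}_{ed}(\lambda),\qquad \sigma_{ed}\mathrm{meex}(n):=\sum_{\lambda\in\mathcal{P}_{ed}(n)}\mathrm{meex}_{ed}(\lambda).$$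
   Formalization: In the first identity the factor (q;q)^3_∞ is replaced by (-q;q)^3_∞: as displayed the identity is false, since the coefficient of q is 3 on the left (the partition {1} has moex 3) but -3 on the right. *)

theory Defs
  imports
    "HOL-Computational_Algebra.Formal_Power_Series"
    "HOL-Library.Multiset"
begin

definition qpoch :: "'a::comm_ring_1 \<Rightarrow> 'a \<Rightarrow> nat \<Rightarrow> 'a" where
  "qpoch a q n = (\<Prod>k<n. 1 - a * q ^ k)"

text \<open>Limits and infinite sums of formal power series are taken in the library's metric on
  \<^typ>\<open>'a fps\<close>, i.e. coefficientwise stabilisation.\<close>

definition qpoch_inf :: "'a::comm_ring_1 fps \<Rightarrow> 'a fps \<Rightarrow> 'a fps" where
  "qpoch_inf a q = lim (\<lambda>n. qpoch a q n)"

definition sigma_series :: "'a::field fps \<Rightarrow> 'a fps" where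
  "sigma_series q = (\<Sum>n. q ^ (n * (n + 1) div 2) / qpoch (- q) q n)"

definition partitions :: "nat \<Rightarrow> nat multiset set" where
  "partitions n = {M. 0 \<notin># M \<and> sum_mset M = n}"

definition P_ed :: "nat \<Rightarrow> nat multiset set" where
  "P_ed n = {M \<in> partitions n. \<forall>k. even k \<longrightarrow> count M k \<le> 1}"

definition moex :: "nat multiset \<Rightarrow> nat" where
  "moex M = (LEAST k. odd k \<and> k \<notin># M)"

definition meex :: "nat multiset \<Rightarrow> nat" where
  "meex M = (LEAST k. 0 < k \<and> even k \<and> k \<notin># M)"

definition sigma_ed_moex :: "nat \<Rightarrow> nat" where
  "sigma_ed_moex n = (\<Sum>M \<in> P_ed n. moex M)"

definition sigma_ed_meex :: "nat \<Rightarrow> nat" where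
  "sigma_ed_meex n = (\<Sum>M \<in> P_ed n. meex M)"

lemma finite_partitions: "finite (partitions n)"
proof -
  have "partitions n \<subseteq> mset ` {xs. set xs \<subseteq> {..n} \<and> length xs \<le> n}"
  proof
    fix M assume "M \<in> partitions n"
    then have M: "0 \<notin># M" "sum_mset M = n"
      by (auto simp: partitions_def)
    obtain xs where xs: "M = mset xs"
      using ex_mset by metis
    have pos: "0 \<notin> set xs" and sum: "sum_list xs = n"
      using M by (simp_all add: xs sum_mset_sum_list)
    have "length ys \<le> sum_list ys" if "0 \<notin> set ys" for ys :: "nat list"
      using that by (induction ys) auto
    then have "length xs \<le> n"
      using pos sum by blast
    moreover have "set xs \<subseteq> {..n}"
      using member_le_sum_list sum by fastforce
    ultimately show "M \<in> mset ` {xs. set xs \<subseteq> {..n} \<and> length xs \<le> n}"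
      using xs by blast
  qed
  then show ?thesis
    by (rule finite_subset) (intro finite_imageI finite_lists_length_le; simp)
qed

lemma finite_P_ed: "finite (P_ed n)"
  by (rule finite_subset[OF _ finite_partitions[of n]]) (auto simp: P_ed_def)

text \<open>The product formula for the generating function of \<^const>\<open>sigma_ed_moex\<close> must contain
  \<open>(-q;q)\<^sup>3\<close>: with \<open>(q;q)\<^sup>3\<close> in its place, which is how the source displays it, the
  coefficient of \<open>q\<close> would be \<open>-3\<close>, whereas \<^term>\<open>sigma_ed_moex 1\<close> is \<open>3\<close>. Indeed
  \<^term>\<open>moex M\<close> is one plus twice the number of \<open>k \<ge> 1\<close> such that \<open>1, 3, ..., 2k - 1\<close> are all
  parts of \<open>M\<close>, so the generating function is \<open>(-q\<^sup>2;q\<^sup>2) / (q;q\<^sup>2)\<close> times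
  \<open>\<Sum>k\<in>\<int>. q ^ k\<^sup>2\<close>; by the triple product identity this is
  \<open>(q\<^sup>2;q\<^sup>2)\<^sup>2 (-q;q)\<^sup>3 / (q\<^sup>4;q\<^sup>4)\<close>, all products being infinite.\<close>

end

theory Submission
  imports Defs "HOL-Computational_Algebra.Polynomial"
begin

text \<open>
  For a partition \<open>M\<close>, \<open>moex M\<close> is \<open>1\<close> plus twice, and \<open>meex M\<close> is \<open>2\<close> plus twice, the number of
  \<open>k \<ge> 1\<close> such that the first \<open>k\<close> odd (resp. even) numbers all are parts of \<open>M\<close>. Splitting off one
  part at a time shows that the partitions without repeated even part have the generating function
  \<open>G = (-q\<^sup>2;q\<^sup>2) / (q;q\<^sup>2)\<close> (products without index are infinite), and that those among them which
  contain the first \<open>k\<close> odd (resp. even) numbers have the generating function \<open>q ^ k\<^sup>2 G\<close>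
  (resp. \<open>q ^ (k (k + 1)) G / (-q\<^sup>2;q\<^sup>2)\<^sub>k\<close>).
  Summing over \<open>k\<close> gives the second formula at once. For the first one, \<open>1 + 2 \<Sum>k\<ge>1. q ^ k\<^sup>2\<close> equals
  \<open>(-q;q\<^sup>2)\<^sup>2 (q\<^sup>2;q\<^sup>2)\<close>, the limit of the finite Jacobi triple product at \<open>z = 1\<close>; Euler's identity
  \<open>(-q;q) (q;q\<^sup>2) = 1\<close> then simplifies the product.
\<close>

unbundle fps_syntax

section \<open>Limits of formal power series\<close>

instance fps :: (ab_group_add) topological_ab_group_add
proof
  fix f g :: "'a fps"
  show "LIM x nhds f \<times>\<^sub>F nhds g. fst x + snd x :> nhds (f + g)"
  proof (rule tendsto_fpsI)
    fix n
    show "\<forall>\<^sub>F x in nhds f \<times>\<^sub>F nhds g. (fst x + snd x) $ n = (f + g) $ n"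
      using eventually_prodI[OF eventually_fps_nth_eq_nhds_fps[of n f]
          eventually_fps_nth_eq_nhds_fps[of n g]]
      by eventually_elim simp
  qed
  show "(uminus \<longlongrightarrow> - f) (nhds f)"
  proof (rule tendsto_fpsI)
    fix n
    show "\<forall>\<^sub>F x in nhds f. (- x) $ n = (- f) $ n"
      using eventually_fps_nth_eq_nhds_fps[of n f] by eventually_elim simp
  qed
qed

instance fps :: (comm_ring_1) topological_comm_monoid_mult
proof
  fix f g :: "'a fps"
  show "LIM x nhds f \<times>\<^sub>F nhds g. fst x * snd x :> nhds (f * g)"
  proof (rule tendsto_fpsI)
    fix n
    show "\<forall>\<^sub>F x in nhds f \<times>\<^sub>F nhds g. (fst x * snd x) $ n = (f * g) $ n"
      using eventually_prodI[OF eventually_fps_nth_eq_nhds_fps_strong[of n f]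
          eventually_fps_nth_eq_nhds_fps_strong[of n g]]
      by eventually_elim (simp add: fps_mult_nth)
  qed
qed

lemma tendsto_fps_inverse:
  fixes f :: "'a \<Rightarrow> 'b::field fps"
  assumes "(f \<longlongrightarrow> g) F" "g $ 0 \<noteq> 0"
  shows "((\<lambda>x. inverse (f x)) \<longlongrightarrow> inverse g) F"
proof (rule tendsto_fpsI)
  fix n
  have "\<forall>\<^sub>F x in F. \<forall>i\<le>n. f x $ i = g $ i"
    using eventually_fps_nth_eq_nhds_fps_strong assms(1) by (rule eventually_compose_filterlim)
  then show "\<forall>\<^sub>F x in F. inverse (f x) $ n = inverse g $ n"
  proof eventually_elim
    case (elim x)
    then have "f x $ 0 \<noteq> 0"
      using assms(2) by simp
    then have "inverse (f x) - inverse g = inverse (f x) * inverse g * (g - f x)"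
      using assms(2) by (simp add: algebra_simps inverse_mult_eq_1')
    moreover have "(inverse (f x) * inverse g * (g - f x)) $ n = 0"
      unfolding fps_mult_nth[of _ "g - f x"] using elim by (intro sum.neutral) auto
    ultimately show ?case
      by (metis eq_iff_diff_eq_0 fps_sub_nth)
  qed
qed

lemma sums_mult_fps:
  fixes c :: "'a::comm_ring_1 fps"
  shows "f sums s \<Longrightarrow> (\<lambda>n. c * f n) sums (c * s)"
  unfolding sums_def sum_distrib_left[symmetric] by (rule tendsto_mult_left)

lemma LIMSEQ_double: "f \<longlonglongrightarrow> l \<Longrightarrow> (\<lambda>n. f (2 * n)) \<longlonglongrightarrow> l"
  using LIMSEQ_subseq_LIMSEQ[of f l "\<lambda>n. 2 * n"] by (simp add: strict_mono_def comp_def)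

lemma fps_convergentI:
  fixes f :: "nat \<Rightarrow> 'a::group_add fps"
  assumes "\<And>n i. i < n \<Longrightarrow> f (Suc n) $ i = f n $ i"
  shows "convergent f"
proof (rule convergentI, rule tendsto_fpsI)
  fix i
  have stable: "f n $ i = f (Suc i) $ i" if "Suc i \<le> n" for n
    using that by (induction n rule: dec_induct) (simp_all add: assms)
  show "\<forall>\<^sub>F n in sequentially. f n $ i = Abs_fps (\<lambda>i. f (Suc i) $ i) $ i"
    unfolding fps_nth_Abs_fps using eventually_ge_at_top[of "Suc i"]
    by eventually_elim (rule stable)
qed

lemma fps_tannery:
  fixes f :: "nat \<Rightarrow> nat \<Rightarrow> 'a::ab_group_add fps"
  assumes total: "(\<lambda>n. \<Sum>k<n. f n k) \<longlonglongrightarrow> s"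
    and terms: "\<And>k. (\<lambda>n. f n k) \<longlonglongrightarrow> g k"
    and order: "\<And>n k i. i < k \<Longrightarrow> f n k $ i = 0"
  shows "g sums s"
  unfolding sums_def
proof (rule tendsto_fpsI)
  fix i
  have eventually_eq: "\<forall>\<^sub>F n in sequentially. f n k $ i = g k $ i" for k
    using terms by (simp add: tendsto_fps_iff)
  have order_limit: "g k $ i = 0" if "i < k" for k
    using eventually_happens[OF eventually_eq[of k]] order[OF that] by auto
  have "\<forall>\<^sub>F n in sequentially. \<forall>k\<in>{..i}. f n k $ i = g k $ i"
    using eventually_eq by (intro eventually_ball_finite) auto
  moreover have "\<forall>\<^sub>F n in sequentially. (\<Sum>k<n. f n k) $ i = s $ i"
    using total by (simp add: tendsto_fps_iff)
  ultimately show "\<forall>\<^sub>F n in sequentially. (\<Sum>k<n. g k) $ i = s $ i"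
  proof eventually_elim
    case (elim n)
    have "f n k $ i = g k $ i" for k
      using elim(1) order[of i k] order_limit[of k] by (cases "k \<le> i") auto
    then show ?case
      using elim(2) by (simp add: fps_sum_nth)
  qed
qed

lemma fps_mult_power_nth_eq_0:
  fixes f q :: "'a::comm_ring_1 fps"
  assumes "q $ 0 = 0" "i < n"
  shows "(f * q ^ n) $ i = 0"
  using assms by (auto simp: fps_mult_nth startsby_zero_power_prefix intro!: sum.neutral)

lemma fps_divide_eqI:
  fixes f g h :: "'a::field fps"
  assumes "h * g = f" "g $ 0 \<noteq> 0"
  shows "h = f / g"
  using assms by (auto simp: fps_divide_unit mult.assoc inverse_mult_eq_1')

section \<open>Infinite products\<close>

lemma qpoch_0 [simp]: "qpoch a q 0 = 1"
  by (simp add: qpoch_def)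

lemma qpoch_Suc: "qpoch a q (Suc n) = qpoch a q n * (1 - a * q ^ n)"
  by (simp add: qpoch_def)

lemma qpoch_LIMSEQ:
  fixes a q :: "'a::comm_ring_1 fps"
  assumes "q $ 0 = 0"
  shows "qpoch a q \<longlonglongrightarrow> qpoch_inf a q"
proof -
  have "qpoch a q (Suc n) $ i = qpoch a q n $ i" if "i < n" for n i
    using fps_mult_power_nth_eq_0[OF assms that, of "qpoch a q n * a"]
    by (simp add: qpoch_Suc algebra_simps)
  then have "convergent (qpoch a q)"
    by (rule fps_convergentI)
  then show ?thesis
    unfolding qpoch_inf_def by (rule convergent_LIMSEQ_iff[THEN iffD1])
qed

lemma qpoch_nth_0:
  fixes a q :: "'a::comm_ring_1 fps"
  assumes "a $ 0 = 0"
  shows "qpoch a q n $ 0 = 1"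
  using assms by (induction n) (simp_all add: qpoch_Suc)

lemma qpoch_inf_nth_0:
  fixes a q :: "'a::comm_ring_1 fps"
  assumes "q $ 0 = 0" "a $ 0 = 0"
  shows "qpoch_inf a q $ 0 = 1"
proof -
  have "\<forall>\<^sub>F n in sequentially. qpoch a q n $ 0 = qpoch_inf a q $ 0"
    using qpoch_LIMSEQ[OF assms(1)] by (simp only: tendsto_fps_iff)
  then show ?thesis
    using assms(2) by (simp add: qpoch_nth_0)
qed

lemma prod_lessThan_double:
  fixes f :: "nat \<Rightarrow> 'a::comm_monoid_mult"
  shows "(\<Prod>i<2 * n. f i) = (\<Prod>i<n. f (2 * i)) * (\<Prod>i<n. f (2 * i + 1))"
  by (induction n) (simp_all add: mult_ac)

lemma qpoch_inf_even_odd: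
  fixes a q :: "'a::comm_ring_1 fps"
  assumes "q $ 0 = 0"
  shows "qpoch_inf a q = qpoch_inf a (q\<^sup>2) * qpoch_inf (a * q) (q\<^sup>2)"
proof (rule LIMSEQ_unique)
  show "(\<lambda>n. qpoch a q (2 * n)) \<longlonglongrightarrow> qpoch_inf a q"
    using assms by (intro LIMSEQ_double qpoch_LIMSEQ)
  have "qpoch a q (2 * n) = qpoch a (q\<^sup>2) n * qpoch (a * q) (q\<^sup>2) n" for n
    by (simp add: qpoch_def prod_lessThan_double power_mult mult.assoc)
  moreover have "(\<lambda>n. qpoch a (q\<^sup>2) n * qpoch (a * q) (q\<^sup>2) n)
      \<longlonglongrightarrow> qpoch_inf a (q\<^sup>2) * qpoch_inf (a * q) (q\<^sup>2)"
    using assms by (intro tendsto_mult qpoch_LIMSEQ) (simp_all add: startsby_zero_power)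
  ultimately show "(\<lambda>n. qpoch a q (2 * n)) \<longlonglongrightarrow> qpoch_inf a (q\<^sup>2) * qpoch_inf (a * q) (q\<^sup>2)"
    by simp
qed

lemma qpoch_inf_mult_uminus:
  fixes a q :: "'a::comm_ring_1 fps"
  assumes "q $ 0 = 0"
  shows "qpoch_inf a q * qpoch_inf (- a) q = qpoch_inf (a\<^sup>2) (q\<^sup>2)"
proof (rule LIMSEQ_unique)
  show "(\<lambda>n. qpoch a q n * qpoch (- a) q n) \<longlonglongrightarrow> qpoch_inf a q * qpoch_inf (- a) q"
    using assms by (intro tendsto_mult qpoch_LIMSEQ)
  have "qpoch a q n * qpoch (- a) q n = qpoch (a\<^sup>2) (q\<^sup>2) n" for n
    by (simp add: qpoch_def prod.distrib[symmetric] algebra_simps power2_eq_square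
        power_mult_distrib)
  then show "(\<lambda>n. qpoch a q n * qpoch (- a) q n) \<longlonglongrightarrow> qpoch_inf (a\<^sup>2) (q\<^sup>2)"
    using qpoch_LIMSEQ[of "q\<^sup>2" "a\<^sup>2"] assms by (simp add: startsby_zero_power)
qed

lemma euler_distinct_odd:
  fixes q :: "'a::field fps"
  assumes "q $ 0 = 0"
  shows "qpoch_inf (- q) q * qpoch_inf q (q\<^sup>2) = 1"
proof -
  have "qpoch_inf (q\<^sup>2) (q\<^sup>2) \<noteq> 0"
    using qpoch_inf_nth_0[of "q\<^sup>2" "q\<^sup>2"] assms by (auto simp: startsby_zero_power)
  moreover have "qpoch_inf (q\<^sup>2) (q\<^sup>2) * (qpoch_inf (- q) q * qpoch_inf q (q\<^sup>2))
      = qpoch_inf (q\<^sup>2) (q\<^sup>2)"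
    using qpoch_inf_mult_uminus[OF assms, of q] qpoch_inf_even_odd[OF assms, of q]
    by (simp add: power2_eq_square mult_ac)
  ultimately show ?thesis
    by simp
qed

section \<open>Theta functions\<close>

fun gauss_binomial :: "'a::comm_ring_1 \<Rightarrow> nat \<Rightarrow> nat \<Rightarrow> 'a" where
  "gauss_binomial q n 0 = 1"
| "gauss_binomial q 0 (Suc k) = 0"
| "gauss_binomial q (Suc n) (Suc k) = gauss_binomial q n k + q ^ Suc k * gauss_binomial q n (Suc k)"

lemma gauss_binomial_eq_0: "n < k \<Longrightarrow> gauss_binomial q n k = 0"
  by (induction q n k rule: gauss_binomial.induct) auto

lemma gauss_binomial_self [simp]: "gauss_binomial q n n = 1"
  by (induction n) (auto simp: gauss_binomial_eq_0)

lemma gauss_binomial_qpoch: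
  "gauss_binomial q (a + b) a * qpoch q q a * qpoch q q b = qpoch q q (a + b)"
proof (induction a arbitrary: b)
  case (Suc a)
  note outer_IH = Suc.IH
  show ?case
  proof (induction b)
    case (Suc b)
    let ?m = "Suc (a + b)"
    have "gauss_binomial q (Suc a + Suc b) (Suc a) * qpoch q q (Suc a) * qpoch q q (Suc b)
        = (gauss_binomial q (a + Suc b) a * qpoch q q a * qpoch q q (Suc b)) * (1 - q ^ Suc a)
          + q ^ Suc a * (gauss_binomial q (Suc a + b) (Suc a) * qpoch q q (Suc a) * qpoch q q b)
              * (1 - q ^ Suc b)"
      by (simp add: qpoch_Suc algebra_simps)
    also have "\<dots> = qpoch q q ?m * (1 - q ^ Suc a) + q ^ Suc a * qpoch q q ?m * (1 - q ^ Suc b)"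
      using outer_IH[of "Suc b"] Suc.IH by (simp add: mult.assoc)
    also have "\<dots> = qpoch q q ?m * (1 - q ^ (Suc a + Suc b))"
      by (simp only: power_add) (simp add: algebra_simps)
    finally show ?case
      by (simp add: qpoch_Suc)
  qed simp
qed simp

lemma power_mult_gauss_binomial:
  "q ^ k * (q ^ (n - k) * gauss_binomial q n k) = q ^ n * gauss_binomial q n k"
proof (cases "k \<le> n")
  case True
  then have "q ^ k * q ^ (n - k) = q ^ n"
    by (simp flip: power_add)
  then show ?thesis
    by (simp only: mult.assoc[symmetric])
qed (simp add: gauss_binomial_eq_0)

lemma gauss_binomial_dual_recurrence:
  "gauss_binomial q (Suc n) (Suc k) =
     q ^ (n - k) * gauss_binomial q n k + gauss_binomial q n (Suc k)"
proof (induction n arbitrary: k)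
  case (Suc n)
  show ?case
  proof (cases k)
    case 0
    then show ?thesis
      using Suc.IH[of 0] by (simp add: algebra_simps)
  next
    case (Suc j)
    let ?b = "gauss_binomial q"
    have "?b (Suc (Suc n)) (Suc k) = ?b (Suc n) (Suc j) + q ^ Suc k * ?b (Suc n) (Suc k)"
      by (simp add: Suc)
    also have "\<dots> = (q ^ (n - j) * ?b n j + ?b n k)
        + (q ^ Suc n * ?b n k + q ^ Suc k * ?b n (Suc k))"
      using power_mult_gauss_binomial[of q k n]
      by (simp only: Suc.IH distrib_left) (simp add: Suc mult.assoc)
    also have "q ^ Suc n * ?b n k = q ^ (n - j) * q ^ k * ?b n k"
    proof (cases "k \<le> n")
      case True
      then have "Suc n = (n - j) + k"
        using Suc by simp
      then show ?thesis
        by (simp only: power_add)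
    qed (simp add: gauss_binomial_eq_0)
    also have "(q ^ (n - j) * ?b n j + ?b n k)
          + (q ^ (n - j) * q ^ k * ?b n k + q ^ Suc k * ?b n (Suc k))
        = q ^ (n - j) * (?b n j + q ^ k * ?b n k) + (?b n k + q ^ Suc k * ?b n (Suc k))"
      by (simp only: distrib_left mult.assoc add_ac)
    also have "\<dots> = q ^ (Suc n - k) * ?b (Suc n) k + ?b (Suc n) (Suc k)"
      by (simp add: Suc)
    finally show ?thesis .
  qed
qed (cases k, simp_all)

lemma gauss_binomial_symmetric: "k \<le> n \<Longrightarrow> gauss_binomial q n k = gauss_binomial q n (n - k)"
proof (induction q n k rule: gauss_binomial.induct)
  case (3 q n k)
  show ?case
  proof (cases "k = n")
    case False
    with "3.prems" obtain j where n: "n = Suc k + j"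
      using le_Suc_ex[of "Suc k" n] by auto
    then have "gauss_binomial q n k = gauss_binomial q n (Suc j)"
      and "gauss_binomial q n (Suc k) = gauss_binomial q n j"
      using "3.IH" by simp_all
    then have "gauss_binomial q (Suc n) (Suc k)
        = q ^ Suc k * gauss_binomial q n j + gauss_binomial q n (Suc j)"
      by (simp only: gauss_binomial.simps add.commute)
    also have "\<dots> = gauss_binomial q (Suc n) (Suc j)"
      using n by (simp only: gauss_binomial_dual_recurrence diff_add_inverse2)
    also have "Suc j = Suc n - Suc k"
      using n by simp
    finally show ?thesis .
  qed simp
qed auto

lemma gauss_binomial_two_step_recurrence:
  "gauss_binomial q (Suc (Suc n)) (Suc (Suc k)) =
     q ^ (n - k) * gauss_binomial q n k + (1 + q ^ Suc n) * gauss_binomial q n (Suc k)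
     + q ^ Suc (Suc k) * gauss_binomial q n (Suc (Suc k))"
proof -
  let ?b = "gauss_binomial q"
  have "?b (Suc (Suc n)) (Suc (Suc k))
      = ?b (Suc n) (Suc k) + q ^ Suc (Suc k) * ?b (Suc n) (Suc (Suc k))"
    by simp
  also have "\<dots> = (q ^ (n - k) * ?b n k + ?b n (Suc k))
      + (q * (q ^ Suc k * (q ^ (n - Suc k) * ?b n (Suc k))) + q ^ Suc (Suc k) * ?b n (Suc (Suc k)))"
    by (simp only: gauss_binomial_dual_recurrence distrib_left) (simp add: mult_ac)
  finally show ?thesis
    unfolding power_mult_gauss_binomial by (simp add: algebra_simps)
qed

lemma centered_square_left:
  "2 * n + 1 + nat ((int k - int n)\<^sup>2) = nat ((int k - int (Suc n))\<^sup>2) + 2 * k"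
proof -
  have "int (nat (x\<^sup>2)) = x\<^sup>2" for x :: int
    by simp
  then have "int (2 * n + 1 + nat ((int k - int n)\<^sup>2))
      = int (nat ((int k - int (Suc n))\<^sup>2) + 2 * k)"
    by (simp only: of_nat_add of_nat_mult) (simp add: power2_eq_square algebra_simps)
  then show ?thesis
    by (simp only: of_nat_eq_iff)
qed

lemma centered_square_right:
  assumes "k \<le> 2 * n"
  shows "2 * n + 1 + nat ((int k - int n)\<^sup>2) = nat ((int (Suc k) - int n)\<^sup>2) + 2 * (2 * n - k)"
proof -
  have "int (nat (x\<^sup>2)) = x\<^sup>2" for x :: int
    by simp
  then have "int (2 * n + 1 + nat ((int k - int n)\<^sup>2))
      = int (nat ((int (Suc k) - int n)\<^sup>2) + 2 * (2 * n - k))"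
    using assms
    by (simp only: of_nat_add of_nat_mult of_nat_diff) (simp add: power2_eq_square algebra_simps)
  then show ?thesis
    by (simp only: of_nat_eq_iff)
qed

definition jacobi_coeff :: "'a::comm_ring_1 \<Rightarrow> nat \<Rightarrow> nat \<Rightarrow> 'a" where
  "jacobi_coeff q n k = q ^ nat ((int k - int n)\<^sup>2) * gauss_binomial (q\<^sup>2) (2 * n) k"

lemma jacobi_coeff_eq_0: "2 * n < k \<Longrightarrow> jacobi_coeff q n k = 0"
  by (simp add: jacobi_coeff_def gauss_binomial_eq_0)

lemma jacobi_coeff_centered:
  assumes "k \<le> n"
  shows "jacobi_coeff q n (n - k) = q ^ k\<^sup>2 * gauss_binomial (q\<^sup>2) (2 * n) (n + k)"
    and "jacobi_coeff q n (n + k) = q ^ k\<^sup>2 * gauss_binomial (q\<^sup>2) (2 * n) (n + k)"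
proof -
  have square: "nat ((int k)\<^sup>2) = k\<^sup>2"
    by (simp only: of_nat_power[symmetric] nat_int)
  have "int (n - k) - int n = - int k"
    using assms by simp
  moreover have "gauss_binomial (q\<^sup>2) (2 * n) (n - k) = gauss_binomial (q\<^sup>2) (2 * n) (n + k)"
    using assms gauss_binomial_symmetric[of "n - k" "2 * n" "q\<^sup>2"] by simp
  ultimately show "jacobi_coeff q n (n - k) = q ^ k\<^sup>2 * gauss_binomial (q\<^sup>2) (2 * n) (n + k)"
    by (simp only: jacobi_coeff_def power2_minus square)
  show "jacobi_coeff q n (n + k) = q ^ k\<^sup>2 * gauss_binomial (q\<^sup>2) (2 * n) (n + k)"
    by (simp add: jacobi_coeff_def square)
qed

lemma jacobi_coeff_shift:
  fixes q :: "'a::comm_ring_1" and n :: nat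
  defines "Q \<equiv> q ^ (2 * n + 1)" and "e \<equiv> \<lambda>k. nat ((int k - int (Suc n))\<^sup>2)"
  shows "Q * jacobi_coeff q n k = q ^ e k * ((q\<^sup>2) ^ k * gauss_binomial (q\<^sup>2) (2 * n) k)"
    and "(1 + Q\<^sup>2) * jacobi_coeff q n k
      = q ^ e (Suc k) * ((1 + (q\<^sup>2) ^ Suc (2 * n)) * gauss_binomial (q\<^sup>2) (2 * n) k)"
    and "Q * jacobi_coeff q n k
      = q ^ e (Suc (Suc k)) * ((q\<^sup>2) ^ (2 * n - k) * gauss_binomial (q\<^sup>2) (2 * n) k)"
proof -
  show "Q * jacobi_coeff q n k = q ^ e k * ((q\<^sup>2) ^ k * gauss_binomial (q\<^sup>2) (2 * n) k)"
    by (simp only: Q_def e_def jacobi_coeff_def mult.assoc[symmetric] power_mult[symmetric]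
        power_add[symmetric] centered_square_left)
  have "Q\<^sup>2 = (q\<^sup>2) ^ Suc (2 * n)"
    by (simp only: Q_def power_mult[symmetric] mult.commute Suc_eq_plus1)
  moreover have "e (Suc k) = nat ((int k - int n)\<^sup>2)"
    by (simp add: e_def)
  ultimately show "(1 + Q\<^sup>2) * jacobi_coeff q n k
      = q ^ e (Suc k) * ((1 + (q\<^sup>2) ^ Suc (2 * n)) * gauss_binomial (q\<^sup>2) (2 * n) k)"
    by (simp only: jacobi_coeff_def mult.left_commute)
  show "Q * jacobi_coeff q n k
      = q ^ e (Suc (Suc k)) * ((q\<^sup>2) ^ (2 * n - k) * gauss_binomial (q\<^sup>2) (2 * n) k)"
  proof (cases "k \<le> 2 * n")
    case True
    have "e (Suc (Suc k)) = nat ((int (Suc k) - int n)\<^sup>2)"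
      by (simp add: e_def add_diff_eq)
    with True show ?thesis
      by (simp only: Q_def jacobi_coeff_def mult.assoc[symmetric] power_mult[symmetric]
          power_add[symmetric] centered_square_right)
  qed (simp only: not_le jacobi_coeff_def gauss_binomial_eq_0 mult_zero_right)
qed

lemma jacobi_coeff_Suc:
  fixes q :: "'a::comm_ring_1" and n :: nat
  defines "Q \<equiv> q ^ (2 * n + 1)"
  shows "jacobi_coeff q (Suc n) 0 = Q * jacobi_coeff q n 0"
    and "jacobi_coeff q (Suc n) (Suc 0)
      = Q * jacobi_coeff q n (Suc 0) + (1 + Q\<^sup>2) * jacobi_coeff q n 0"
    and "jacobi_coeff q (Suc n) (Suc (Suc k)) = Q * jacobi_coeff q n (Suc (Suc k))
      + (1 + Q\<^sup>2) * jacobi_coeff q n (Suc k) + Q * jacobi_coeff q n k"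
proof -
  let ?b = "gauss_binomial (q\<^sup>2)"
  show "jacobi_coeff q (Suc n) 0 = Q * jacobi_coeff q n 0"
    unfolding Q_def jacobi_coeff_shift(1) by (simp add: jacobi_coeff_def)
  have "?b (2 * Suc n) (Suc 0)
      = (1 + (q\<^sup>2) ^ Suc (2 * n)) * ?b (2 * n) 0 + (q\<^sup>2) ^ Suc 0 * ?b (2 * n) (Suc 0)"
    using gauss_binomial_dual_recurrence[of "q\<^sup>2" "2 * n" 0] by (simp add: algebra_simps)
  then show "jacobi_coeff q (Suc n) (Suc 0)
      = Q * jacobi_coeff q n (Suc 0) + (1 + Q\<^sup>2) * jacobi_coeff q n 0"
    unfolding Q_def jacobi_coeff_shift(1,2) jacobi_coeff_def[of q "Suc n"]
    by (simp only: distrib_left add.commute)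
  have "?b (2 * Suc n) (Suc (Suc k)) = (q\<^sup>2) ^ (2 * n - k) * ?b (2 * n) k
      + (1 + (q\<^sup>2) ^ Suc (2 * n)) * ?b (2 * n) (Suc k)
      + (q\<^sup>2) ^ Suc (Suc k) * ?b (2 * n) (Suc (Suc k))"
    by (simp only: mult_Suc_right add_2_eq_Suc gauss_binomial_two_step_recurrence)
  then show "jacobi_coeff q (Suc n) (Suc (Suc k)) = Q * jacobi_coeff q n (Suc (Suc k))
      + (1 + Q\<^sup>2) * jacobi_coeff q n (Suc k) + Q * jacobi_coeff q n k"
    unfolding Q_def jacobi_coeff_shift(1)[of q n "Suc (Suc k)"] jacobi_coeff_shift(2)
      jacobi_coeff_shift(3)[of q n k] jacobi_coeff_def[of q "Suc n"]
    by (simp only: distrib_left add_ac)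
qed

text \<open>The factor \<open>[:q ^ (2 * i + 1), 1:]\<close> is \<open>z * (1 + q ^ (2 * i + 1) / z)\<close>, so the coefficient
  of \<open>z ^ k\<close> is that of \<open>z ^ (k - n)\<close> in the usual form of the product.\<close>

lemma finite_jacobi_triple_product:
  "coeff (\<Prod>i<n. [:1, q ^ (2 * i + 1):] * [:q ^ (2 * i + 1), 1:]) k = jacobi_coeff q n k"
proof (induction n arbitrary: k)
  case 0
  then show ?case
    by (cases k) (auto simp: jacobi_coeff_def)
next
  case (Suc n)
  let ?Q = "q ^ (2 * n + 1)" and ?P = "\<lambda>n. \<Prod>i<n. [:1, q ^ (2 * i + 1):] * [:q ^ (2 * i + 1), 1:]"
  have P_Suc: "?P (Suc n) = [:?Q, 1 + ?Q\<^sup>2, ?Q:] * ?P n"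
    by (simp only: prod.lessThan_Suc mult.commute[of "?P n"])
      (simp add: power2_eq_square add.commute)
  consider (zero) "k = 0" | (one) "k = Suc 0" | (add_two) j where "k = Suc (Suc j)"
    by (metis not0_implies_Suc)
  then show ?case
  proof cases
    case zero
    have "coeff (?P (Suc n)) 0 = ?Q * coeff (?P n) 0"
      unfolding P_Suc by simp
    then show ?thesis
      by (simp only: zero Suc.IH jacobi_coeff_Suc)
  next
    case one
    have "coeff (?P (Suc n)) (Suc 0) = ?Q * coeff (?P n) (Suc 0) + (1 + ?Q\<^sup>2) * coeff (?P n) 0"
      unfolding P_Suc by simp
    then show ?thesis
      by (simp only: one Suc.IH jacobi_coeff_Suc)
  next
    case add_two
    have "coeff (?P (Suc n)) (Suc (Suc j))
        = ?Q * coeff (?P n) (Suc (Suc j)) + (1 + ?Q\<^sup>2) * coeff (?P n) (Suc j) + ?Q * coeff (?P n) j"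
      unfolding P_Suc by simp
    then show ?thesis
      by (simp only: add_two Suc.IH jacobi_coeff_Suc)
  qed
qed

lemma sum_atMost_double_centered:
  fixes f :: "nat \<Rightarrow> 'a::comm_monoid_add"
  shows "(\<Sum>k\<le>2 * n. f k) = f n + (\<Sum>k<n. f (n - Suc k) + f (n + Suc k))"
proof -
  have "(\<Sum>k\<le>n + m. f k) = (\<Sum>k<n. f k) + (f n + (\<Sum>k<m. f (n + Suc k)))" for m
    by (induction m) (simp_all add: lessThan_Suc_atMost[symmetric] add_ac)
  from this[of n] show ?thesis
    by (simp add: sum.distrib sum.nat_diff_reindex add_ac flip: mult_2)
qed

lemma qpoch_square_eq_sum_gauss_binomial:
  fixes q :: "'a::comm_ring_1"
  shows "qpoch (- q) (q\<^sup>2) n ^ 2 = gauss_binomial (q\<^sup>2) (2 * n) n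
    + (\<Sum>k<n. 2 * q ^ (Suc k)\<^sup>2 * gauss_binomial (q\<^sup>2) (2 * n) (n + Suc k))"
proof -
  define P where "P = (\<Prod>i<n. [:1, q ^ (2 * i + 1):] * [:q ^ (2 * i + 1), 1:])"
  have coeff_P: "coeff P k = jacobi_coeff q n k" for k
    unfolding P_def by (rule finite_jacobi_triple_product)
  then have "degree P \<le> 2 * n"
    by (simp add: degree_le jacobi_coeff_eq_0)
  have "qpoch (- q) (q\<^sup>2) n ^ 2 = (\<Prod>i<n. (1 + q ^ (2 * i + 1)) * (1 + q ^ (2 * i + 1)))"
    by (simp add: qpoch_def prod.distrib power2_eq_square power_mult)
  also have "\<dots> = poly P 1"
    by (simp only: P_def poly_prod poly_mult) (simp add: add.commute)
  also have "\<dots> = poly (\<Sum>k\<le>2 * n. monom (coeff P k) k) 1"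
    by (simp only: poly_as_sum_of_monoms'[OF \<open>degree P \<le> 2 * n\<close>])
  also have "\<dots> = (\<Sum>k\<le>2 * n. jacobi_coeff q n k)"
    by (simp add: poly_sum poly_monom coeff_P)
  also have "\<dots> = jacobi_coeff q n n
      + (\<Sum>k<n. jacobi_coeff q n (n - Suc k) + jacobi_coeff q n (n + Suc k))"
    by (rule sum_atMost_double_centered)
  also have "(\<Sum>k<n. jacobi_coeff q n (n - Suc k) + jacobi_coeff q n (n + Suc k))
      = (\<Sum>k<n. 2 * q ^ (Suc k)\<^sup>2 * gauss_binomial (q\<^sup>2) (2 * n) (n + Suc k))"
    by (intro sum.cong)
      (simp_all only: jacobi_coeff_centered Suc_le_eq lessThan_iff mult_2 distrib_right)
  also have "jacobi_coeff q n n = gauss_binomial (q\<^sup>2) (2 * n) n"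
    by (simp add: jacobi_coeff_def)
  finally show ?thesis .
qed

lemma gauss_binomial_tendsto:
  fixes q :: "'a::field fps"
  assumes q: "q $ 0 = 0" and "filterlim a sequentially F" "filterlim b sequentially F"
  shows "((\<lambda>x. gauss_binomial q (a x + b x) (a x)) \<longlongrightarrow> inverse (qpoch_inf q q)) F"
proof -
  let ?P = "qpoch q q" and ?P_inf = "qpoch_inf q q"
  have unit: "?P n $ 0 = 1" "?P_inf $ 0 = 1" for n
    using q by (simp_all add: qpoch_nth_0 qpoch_inf_nth_0)
  have lim: "((\<lambda>x. ?P (c x)) \<longlongrightarrow> ?P_inf) F" if "filterlim c sequentially F" for c
    using qpoch_LIMSEQ[OF q] that by (rule filterlim_compose)
  have "filterlim (\<lambda>x. a x + b x) sequentially F"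
    by (rule filterlim_at_top_mono[OF assms(2)]) simp
  then have "((\<lambda>x. ?P (a x + b x) * inverse (?P (a x)) * inverse (?P (b x)))
      \<longlongrightarrow> ?P_inf * inverse ?P_inf * inverse ?P_inf) F"
    using assms by (intro tendsto_mult tendsto_fps_inverse lim) (simp_all add: unit)
  moreover have "?P (m + n) * inverse (?P m) * inverse (?P n) = gauss_binomial q (m + n) m" for m n
  proof -
    have "?P (m + n) * inverse (?P m) * inverse (?P n)
        = gauss_binomial q (m + n) m * (?P m * inverse (?P m)) * (?P n * inverse (?P n))"
      by (simp only: gauss_binomial_qpoch[symmetric] mult_ac)
    then show ?thesis
      by (simp add: unit inverse_mult_eq_1')
  qed
  ultimately show ?thesis
    by (simp add: unit inverse_mult_eq_1')
qed

lemma gauss_theta_sums: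
  fixes q :: "'a::field fps"
  assumes q: "q $ 0 = 0"
  shows "(\<lambda>k. 2 * q ^ (Suc k)\<^sup>2) sums (qpoch_inf (- q) (q\<^sup>2) ^ 2 * qpoch_inf (q\<^sup>2) (q\<^sup>2) - 1)"
proof -
  let ?b = "gauss_binomial (q\<^sup>2)" and ?D = "qpoch_inf (- q) (q\<^sup>2)" and ?P = "qpoch_inf (q\<^sup>2) (q\<^sup>2)"
  have q2: "q\<^sup>2 $ 0 = 0"
    using q by (simp add: startsby_zero_power)
  have binomial_lim: "(\<lambda>n. ?b (2 * n) (n + k)) \<longlonglongrightarrow> inverse ?P" for k
  proof (rule LIMSEQ_offset)
    have "(\<lambda>n. ?b ((n + 2 * k) + n) (n + 2 * k)) \<longlonglongrightarrow> inverse ?P"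
      by (intro gauss_binomial_tendsto q2 filterlim_ident filterlim_add_const_nat_at_top)
    then show "(\<lambda>n. ?b (2 * (n + k)) (n + k + k)) \<longlonglongrightarrow> inverse ?P"
      by (simp add: algebra_simps flip: mult_2)
  qed
  have "(\<lambda>k. 2 * q ^ (Suc k)\<^sup>2 * inverse ?P) sums (?D ^ 2 - inverse ?P)"
  proof (rule fps_tannery)
    show "(\<lambda>n. 2 * q ^ (Suc k)\<^sup>2 * ?b (2 * n) (n + Suc k)) \<longlonglongrightarrow> 2 * q ^ (Suc k)\<^sup>2 * inverse ?P" for k
      by (intro tendsto_mult tendsto_const binomial_lim)
    have "(\<lambda>n. qpoch (- q) (q\<^sup>2) n ^ 2 - ?b (2 * n) n) \<longlonglongrightarrow> ?D ^ 2 - inverse ?P"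
      using binomial_lim[of 0]
      by (intro tendsto_diff tendsto_power_strong tendsto_const qpoch_LIMSEQ q2) simp
    then show "(\<lambda>n. \<Sum>k<n. 2 * q ^ (Suc k)\<^sup>2 * ?b (2 * n) (n + Suc k)) \<longlonglongrightarrow> ?D ^ 2 - inverse ?P"
      by (simp add: qpoch_square_eq_sum_gauss_binomial)
    show "(2 * q ^ (Suc k)\<^sup>2 * ?b (2 * n) (n + Suc k)) $ i = 0" if "i < k" for n k i
    proof -
      have "i < (Suc k)\<^sup>2"
        using that by (simp add: power2_eq_square)
      from fps_mult_power_nth_eq_0[OF q this, of "2 * ?b (2 * n) (n + Suc k)"] show ?thesis
        by (simp only: mult_ac)
    qed
  qed
  from sums_mult_fps[OF this, of ?P] show ?thesis
    using qpoch_inf_nth_0[OF q2 q2] by (simp add: inverse_mult_eq_1' algebra_simps)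
qed

section \<open>Partitions with restricted repetitions\<close>

definition partition_series :: "nat multiset set \<Rightarrow> 'a::comm_ring_1 fps" where
  "partition_series S = Abs_fps (\<lambda>n. of_nat (card (S \<inter> partitions n)))"

lemma partition_series_nth: "partition_series S $ n = of_nat (card (S \<inter> partitions n))"
  by (simp add: partition_series_def)

lemma partition_series_split:
  "partition_series S = partition_series {M \<in> S. j \<notin># M} + partition_series {M \<in> S. j \<in># M}"
proof (rule fps_ext)
  fix n
  have "S \<inter> partitions n = {M \<in> S. j \<notin># M} \<inter> partitions n \<union> {M \<in> S. j \<in># M} \<inter> partitions n"
    by auto
  then have "card (S \<inter> partitions n)
      = card ({M \<in> S. j \<notin># M} \<inter> partitions n) + card ({M \<in> S. j \<in># M} \<inter> partitions n)"
    using card_Un_disjoint[of "{M \<in> S. j \<notin># M} \<inter> partitions n" "{M \<in> S. j \<in># M} \<inter> partitions n"]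
    by (auto simp: finite_partitions)
  then show "partition_series S $ n
      = (partition_series {M \<in> S. j \<notin># M} + partition_series {M \<in> S. j \<in># M}) $ n"
    by (simp add: partition_series_nth)
qed

lemma partition_series_containing:
  assumes "0 < j"
  shows "partition_series {M \<in> S. j \<in># M} = fps_X ^ j * partition_series {M. add_mset j M \<in> S}"
proof (rule fps_ext)
  fix n
  have "add_mset j M \<in> partitions n \<longleftrightarrow> j \<le> n \<and> M \<in> partitions (n - j)" for M
    using assms by (auto simp: partitions_def)
  then have "{M \<in> S. j \<in># M} \<inter> partitions n
      = (if j \<le> n then add_mset j ` ({M. add_mset j M \<in> S} \<inter> partitions (n - j)) else {})"
    by (auto dest!: multi_member_split)
  then show "partition_series {M \<in> S. j \<in># M} $ n
      = (fps_X ^ j * partition_series {M. add_mset j M \<in> S}) $ n"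
    by (simp add: partition_series_nth fps_X_power_mult_nth card_image inj_on_def)
qed

lemma part_in_atLeastAtMost: "M \<in> partitions n \<Longrightarrow> x \<in># M \<Longrightarrow> x \<in> {1..n}"
  by (cases x) (auto simp: partitions_def dest: multi_member_split)

lemma partition_series_bounded_LIMSEQ:
  "(\<lambda>N. partition_series {M \<in> S. set_mset M \<subseteq> {1..N}}) \<longlonglongrightarrow> partition_series S"
proof (rule tendsto_fpsI)
  fix n
  have "{M \<in> S. set_mset M \<subseteq> {1..N}} \<inter> partitions n = S \<inter> partitions n" if "n \<le> N" for N
    using that part_in_atLeastAtMost by fastforce
  then show "\<forall>\<^sub>F N in sequentially.
      partition_series {M \<in> S. set_mset M \<subseteq> {1..N}} $ n = partition_series S $ n"
    unfolding eventually_sequentially partition_series_nth by metis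
qed

definition distinct_in :: "nat set \<Rightarrow> nat multiset set" where
  "distinct_in D = {M. \<forall>j\<in>D. count M j \<le> 1}"

lemma add_mset_in_distinct_in_iff:
  "add_mset j M \<in> distinct_in D \<longleftrightarrow> M \<in> distinct_in D \<and> (j \<in> D \<longrightarrow> j \<notin># M)"
  by (auto simp: distinct_in_def not_in_iff le_Suc_eq split: if_splits)

abbreviation distinct_even :: "nat multiset set" where
  "distinct_even \<equiv> distinct_in (Collect even)"

lemma P_ed_eq: "P_ed n = distinct_even \<inter> partitions n"
  by (auto simp: P_ed_def distinct_in_def)

lemma partition_series_distinct_in_insert:
  fixes D :: "nat set"
  defines "G \<equiv> \<lambda>J. partition_series {M \<in> distinct_in D. set_mset M \<subseteq> J} :: 'a::comm_ring_1 fps"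
  assumes "0 < j" "j \<notin> J"
  shows "j \<in> D \<Longrightarrow> G (insert j J) = G J * (1 + fps_X ^ j)"
    and "j \<notin> D \<Longrightarrow> G (insert j J) * (1 - fps_X ^ j) = G J"
proof -
  let ?C = "\<lambda>J. {M \<in> distinct_in D. set_mset M \<subseteq> J}"
  have "{M \<in> ?C (insert j J). j \<notin># M} = ?C J"
    using \<open>j \<notin> J\<close> by auto
  then have G_insert: "G (insert j J)
      = G J + fps_X ^ j * partition_series {M. add_mset j M \<in> ?C (insert j J)}"
    using partition_series_split[of "?C (insert j J)" j]
    by (simp only: G_def partition_series_containing[OF \<open>0 < j\<close>])
  show "G (insert j J) = G J * (1 + fps_X ^ j)" if "j \<in> D"
  proof -
    have "{M. add_mset j M \<in> ?C (insert j J)} = ?C J"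
      using that \<open>j \<notin> J\<close> by (auto simp: add_mset_in_distinct_in_iff)
    then show ?thesis
      using G_insert by (simp add: G_def algebra_simps)
  qed
  show "G (insert j J) * (1 - fps_X ^ j) = G J" if "j \<notin> D"
  proof -
    have "{M. add_mset j M \<in> ?C (insert j J)} = ?C (insert j J)"
      using that by (auto simp: add_mset_in_distinct_in_iff)
    then show ?thesis
      using G_insert by (simp add: G_def algebra_simps)
  qed
qed

lemma partition_series_distinct_in_parts:
  assumes "finite J" "0 \<notin> J"
  shows "partition_series {M \<in> distinct_in D. set_mset M \<subseteq> J} * (\<Prod>j\<in>J - D. 1 - fps_X ^ j)
    = (\<Prod>j\<in>J \<inter> D. 1 + fps_X ^ j :: 'a::comm_ring_1 fps)"
  using assms
proof (induction J rule: finite_induct)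
  case empty
  have "{M \<in> distinct_in D. set_mset M \<subseteq> {}} \<inter> partitions n = (if n = 0 then {{#}} else {})" for n
    by (auto simp: distinct_in_def partitions_def)
  then show ?case
    by (simp add: fps_eq_iff partition_series_nth)
next
  case (insert j J)
  note G_insert = partition_series_distinct_in_insert[OF _ \<open>j \<notin> J\<close>, of D, where 'a = 'a]
  show ?case
  proof (cases "j \<in> D")
    case True
    with insert G_insert(1) show ?thesis
      by (simp add: Int_insert_left insert_Diff_if mult_ac)
  next
    case False
    with insert G_insert(2) show ?thesis
      by (simp add: Int_insert_left insert_Diff_if mult.assoc[symmetric])
  qed
qed

lemma partition_series_distinct_in_containing:
  assumes "finite K" "0 \<notin> K"
  shows "partition_series {M \<in> distinct_in D. K \<subseteq> set_mset M} * (\<Prod>j\<in>K \<inter> D. 1 + fps_X ^ j)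
    = fps_X ^ \<Sum>K * (partition_series (distinct_in D) :: 'a::comm_ring_1 fps)"
  using assms
proof (induction K rule: finite_induct)
  case (insert j K)
  let ?C = "\<lambda>K. {M \<in> distinct_in D. K \<subseteq> set_mset M}"
  let ?G = "\<lambda>K. partition_series (?C K) :: 'a fps"
  have j: "0 < j"
    using insert.prems by auto
  have IH: "?G K * (\<Prod>j\<in>K \<inter> D. 1 + fps_X ^ j) = fps_X ^ \<Sum>K * partition_series (distinct_in D)"
    using insert by simp
  have "?C (insert j K) = {M \<in> ?C K. j \<in># M}"
    by auto
  then have G_insert: "?G (insert j K) = fps_X ^ j * partition_series {M. add_mset j M \<in> ?C K}"
    by (simp only: partition_series_containing[OF j])
  show ?case
  proof (cases "j \<in> D")
    case True
    then have "{M. add_mset j M \<in> ?C K} = {M \<in> ?C K. j \<notin># M}"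
      using \<open>j \<notin> K\<close> by (auto simp: add_mset_in_distinct_in_iff)
    moreover have "?G K = partition_series {M \<in> ?C K. j \<notin># M} + ?G (insert j K)"
      using partition_series_split[of "?C K" j] \<open>?C (insert j K) = {M \<in> ?C K. j \<in># M}\<close> by simp
    ultimately have "?G (insert j K) * (1 + fps_X ^ j) = fps_X ^ j * ?G K"
      using G_insert by (simp add: algebra_simps)
    then have "?G (insert j K) * (\<Prod>j\<in>insert j K \<inter> D. 1 + fps_X ^ j)
        = fps_X ^ j * (?G K * (\<Prod>j\<in>K \<inter> D. 1 + fps_X ^ j))"
      using True insert.hyps by (simp add: Int_insert_left mult.assoc[symmetric])
    then show ?thesis
      using insert.hyps by (simp add: IH power_add mult.assoc)
  next
    case False
    then have "{M. add_mset j M \<in> ?C K} = ?C K"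
      using \<open>j \<notin> K\<close> by (auto simp: add_mset_in_distinct_in_iff)
    then show ?thesis
      using False G_insert insert.hyps IH by (simp add: Int_insert_left power_add mult.assoc)
  qed
qed simp

lemma inj_on_double_add: "inj_on (\<lambda>i::nat. 2 * i + c) A"
  by (simp add: inj_on_def)

lemma odd_in_atLeastAtMost_double: "{1..2 * n :: nat} - Collect even = (\<lambda>i. 2 * i + 1) ` {..<n}"
proof safe
  fix j :: nat assume "j \<in> {1..2 * n}" "j \<notin> (\<lambda>i. 2 * i + 1) ` {..<n}"
  then show "even j"
    by (cases "odd j") (auto elim!: oddE)
qed auto

lemma even_in_atLeastAtMost_double: "{1..2 * n :: nat} \<inter> Collect even = (\<lambda>i. 2 * i + 2) ` {..<n}"
proof safe
  fix j :: nat assume "j \<in> {1..2 * n}" "even j"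
  then show "j \<in> (\<lambda>i. 2 * i + 2) ` {..<n}"
    by (intro image_eqI[of _ _ "j div 2 - 1"]) auto
qed auto

lemma partition_series_distinct_even:
  fixes q :: "'a::comm_ring_1 fps"
  defines "q \<equiv> fps_X"
  shows "partition_series distinct_even * qpoch_inf q (q\<^sup>2) = qpoch_inf (- (q\<^sup>2)) (q\<^sup>2)"
proof (rule LIMSEQ_unique)
  let ?C = "\<lambda>N. {M \<in> distinct_even. set_mset M \<subseteq> {1..N}}"
  have q2: "q\<^sup>2 $ 0 = 0"
    by (simp add: q_def)
  show "(\<lambda>n. partition_series (?C (2 * n)) * qpoch q (q\<^sup>2) n)
      \<longlonglongrightarrow> partition_series distinct_even * qpoch_inf q (q\<^sup>2)"
    by (intro tendsto_mult LIMSEQ_double[OF partition_series_bounded_LIMSEQ] qpoch_LIMSEQ q2)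
  have "partition_series (?C (2 * n)) * qpoch q (q\<^sup>2) n = qpoch (- (q\<^sup>2)) (q\<^sup>2) n" for n
  proof -
    have "qpoch q (q\<^sup>2) n = (\<Prod>j\<in>{1..2 * n} - Collect even. 1 - fps_X ^ j)"
      unfolding odd_in_atLeastAtMost_double prod.reindex[OF inj_on_double_add]
      by (simp add: qpoch_def q_def flip: power_mult)
    moreover have "qpoch (- (q\<^sup>2)) (q\<^sup>2) n = (\<Prod>j\<in>{1..2 * n} \<inter> Collect even. 1 + fps_X ^ j)"
      unfolding even_in_atLeastAtMost_double prod.reindex[OF inj_on_double_add]
      by (simp add: qpoch_def q_def flip: power_mult power_add)
    ultimately show ?thesis
      by (simp only:) (rule partition_series_distinct_in_parts, auto)
  qed
  then show "(\<lambda>n. partition_series (?C (2 * n)) * qpoch q (q\<^sup>2) n) \<longlonglongrightarrow> qpoch_inf (- (q\<^sup>2)) (q\<^sup>2)"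
    by (simp add: qpoch_LIMSEQ q2)
qed

lemma partition_series_distinct_even_eq_divide:
  fixes q :: "'a::field fps"
  defines "q \<equiv> fps_X"
  shows "partition_series distinct_even = qpoch_inf (- (q\<^sup>2)) (q\<^sup>2) / qpoch_inf q (q\<^sup>2)"
  using qpoch_inf_nth_0[of "q\<^sup>2" q] unfolding q_def
  by (intro fps_divide_eqI partition_series_distinct_even) simp

lemma partition_series_distinct_even_nth_0: "partition_series distinct_even $ 0 = (1 :: 'a::field)"
  using qpoch_inf_nth_0[of "fps_X\<^sup>2" "fps_X :: 'a fps"]
    qpoch_inf_nth_0[of "fps_X\<^sup>2" "- (fps_X\<^sup>2) :: 'a fps"]
  by (simp add: partition_series_distinct_even_eq_divide fps_divide_unit)

lemma partition_series_odd_run: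
  fixes q :: "'a::comm_ring_1 fps"
  defines "q \<equiv> fps_X"
  shows "partition_series {M \<in> distinct_even. (\<lambda>i. 2 * i + 1) ` {..<k} \<subseteq> set_mset M}
    = q ^ k\<^sup>2 * partition_series distinct_even"
proof -
  let ?K = "(\<lambda>i. 2 * i + 1) ` {..<k}"
  have "\<Sum>?K = (\<Sum>i<k. 2 * i + 1)"
    by (rule sum.reindex[OF inj_on_double_add, unfolded comp_def id_def])
  also have "\<dots> = k\<^sup>2"
    by (induction k) (simp_all add: power2_eq_square)
  finally have "\<Sum>?K = k\<^sup>2" .
  moreover have "?K \<inter> Collect even = {}"
    by auto
  ultimately show ?thesis
    using partition_series_distinct_in_containing[of ?K "Collect even", where 'a = 'a]
    by (simp add: q_def image_iff)
qed

lemma partition_series_even_run: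
  fixes q :: "'a::comm_ring_1 fps"
  defines "q \<equiv> fps_X"
  shows "partition_series {M \<in> distinct_even. (\<lambda>i. 2 * i + 2) ` {..<k} \<subseteq> set_mset M}
      * qpoch (- (q\<^sup>2)) (q\<^sup>2) k
    = q ^ (k * (k + 1)) * partition_series distinct_even"
proof -
  let ?K = "(\<lambda>i. 2 * i + 2) ` {..<k}"
  have "\<Sum>?K = (\<Sum>i<k. 2 * i + 2)"
    by (rule sum.reindex[OF inj_on_double_add, unfolded comp_def id_def])
  also have "\<dots> = k * (k + 1)"
    by (induction k) simp_all
  finally have "\<Sum>?K = k * (k + 1)" .
  moreover have "(\<Prod>j\<in>?K. 1 + fps_X ^ j) = qpoch (- (q\<^sup>2)) (q\<^sup>2) k"
    unfolding prod.reindex[OF inj_on_double_add]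
    by (simp add: qpoch_def q_def flip: power_mult power_add)
  moreover have "?K \<inter> Collect even = ?K"
    by auto
  ultimately show ?thesis
    using partition_series_distinct_in_containing[of ?K "Collect even", where 'a = 'a]
    by (simp add: q_def image_iff)
qed

section \<open>Sums of minimal excludants\<close>

definition mex_index :: "(nat \<Rightarrow> nat) \<Rightarrow> nat multiset \<Rightarrow> nat" where
  "mex_index p M = (LEAST i. p i \<notin># M)"

lemma mex_index_notin:
  assumes "inj p"
  shows "p (mex_index p M) \<notin># M"
proof -
  have "\<not> range p \<subseteq> set_mset M"
    using range_inj_infinite[OF assms] finite_subset[OF _ finite_set_mset] by blast
  then have "\<exists>i. p i \<notin># M"
    by auto
  then show ?thesis
    unfolding mex_index_def by (rule LeastI_ex)
qed

lemma less_mex_index_iff: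
  assumes "inj p"
  shows "k < mex_index p M \<longleftrightarrow> p ` {..k} \<subseteq> set_mset M"
proof
  assume "k < mex_index p M"
  then have "p i \<in># M" if "i \<le> k" for i
    using that not_less_Least[of i "\<lambda>i. p i \<notin># M"] by (simp add: mex_index_def)
  then show "p ` {..k} \<subseteq> set_mset M"
    by auto
next
  assume "p ` {..k} \<subseteq> set_mset M"
  then show "k < mex_index p M"
    using mex_index_notin[OF assms] by (meson atMost_iff image_subset_iff not_le_imp_less)
qed

lemma Least_range_notin_eq:
  assumes "strict_mono p"
  shows "(LEAST k. k \<in> range p \<and> k \<notin># M) = p (mex_index p M)"
proof (rule Least_equality)
  show "p (mex_index p M) \<in> range p \<and> p (mex_index p M) \<notin># M"
    using mex_index_notin[OF strict_mono_imp_inj_on[OF assms]] by simp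
next
  fix k assume "k \<in> range p \<and> k \<notin># M"
  then obtain i where "k = p i" "p i \<notin># M"
    by auto
  then show "p (mex_index p M) \<le> k"
    using assms by (simp add: strict_mono_less_eq mex_index_def Least_le)
qed

lemma moex_eq: "moex M = 2 * mex_index (\<lambda>i. 2 * i + 1) M + 1"
proof -
  have "odd k \<longleftrightarrow> k \<in> range (\<lambda>i. 2 * i + 1)" for k :: nat
    by (auto elim: oddE)
  then show ?thesis
    using Least_range_notin_eq[of "\<lambda>i. 2 * i + 1" M]
    by (simp add: moex_def strict_mono_def)
qed

lemma meex_eq: "meex M = 2 * mex_index (\<lambda>i. 2 * i + 2) M + 2"
proof -
  have "0 < k \<and> even k \<longleftrightarrow> k \<in> range (\<lambda>i. 2 * i + 2)" for k :: nat
  proof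
    assume "0 < k \<and> even k"
    then show "k \<in> range (\<lambda>i. 2 * i + 2)"
      by (intro image_eqI[of _ _ "k div 2 - 1"]) auto
  qed auto
  then show ?thesis
    using Least_range_notin_eq[of "\<lambda>i. 2 * i + 2" M]
    by (simp add: meex_def strict_mono_def conj_assoc[symmetric])
qed

definition mex_series :: "(nat \<Rightarrow> nat) \<Rightarrow> nat multiset set \<Rightarrow> 'a::comm_ring_1 fps" where
  "mex_series p S = Abs_fps (\<lambda>n. of_nat (\<Sum>M\<in>S \<inter> partitions n. mex_index p M))"

lemma mex_index_eq_card:
  assumes p: "strict_mono p" and M: "M \<in> partitions n" and "n < N"
  shows "mex_index p M = card {k \<in> {..<N}. p ` {..k} \<subseteq> set_mset M}"
proof -
  have less_iff: "k < mex_index p M \<longleftrightarrow> p ` {..k} \<subseteq> set_mset M" for k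
    using p by (intro less_mex_index_iff strict_mono_imp_inj_on)
  have "k < N" if "k < mex_index p M" for k
  proof -
    have "k \<le> p k"
      using p by (rule strict_mono_imp_increasing)
    also have "p k \<le> n"
      using that part_in_atLeastAtMost[OF M, of "p k"] by (auto simp: less_iff)
    also note \<open>n < N\<close>
    finally show ?thesis .
  qed
  then have "{k \<in> {..<N}. p ` {..k} \<subseteq> set_mset M} = {..<mex_index p M}"
    by (auto simp: less_iff[symmetric])
  then show ?thesis
    by simp
qed

lemma mex_series_sums:
  assumes "strict_mono p"
  shows "(\<lambda>k. partition_series {M \<in> S. p ` {..k} \<subseteq> set_mset M}) sums mex_series p S"
  unfolding sums_def
proof (rule tendsto_fpsI)
  fix n
  let ?R = "\<lambda>M k. p ` {..k} \<subseteq> set_mset M"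
  from eventually_gt_at_top[of n]
  show "\<forall>\<^sub>F N in sequentially. (\<Sum>k<N. partition_series {M \<in> S. ?R M k}) $ n = mex_series p S $ n"
  proof eventually_elim
    case (elim N)
    have "(\<Sum>M\<in>S \<inter> partitions n. mex_index p M) = (\<Sum>M\<in>S \<inter> partitions n. card {k \<in> {..<N}. ?R M k})"
      using mex_index_eq_card[OF assms _ elim] by (intro sum.cong) auto
    also have "\<dots> = (\<Sum>k<N. card {M \<in> S \<inter> partitions n. ?R M k})"
      by (rule sum_multicount_gen) (simp_all add: finite_partitions)
    also have "\<dots> = (\<Sum>k<N. card ({M \<in> S. ?R M k} \<inter> partitions n))"
      by (intro sum.cong refl arg_cong[of _ _ card]) auto
    finally show ?case
      by (simp add: fps_sum_nth partition_series_nth mex_series_def flip: of_nat_sum)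
  qed
qed

lemma P_ed_affine_mex_index_series:
  assumes "\<And>M. f M = 2 * mex_index p M + c"
  shows "Abs_fps (\<lambda>n. of_nat (\<Sum>M\<in>P_ed n. f M))
    = 2 * mex_series p distinct_even + of_nat c * partition_series distinct_even"
  by (rule fps_ext)
    (simp add: assms P_ed_eq sum.distrib mex_series_def partition_series_nth mult.commute
      fps_mult_of_nat_nth numeral_fps_const flip: sum_distrib_left)

lemma mex_series_odd:
  fixes q :: "'a::field fps"
  defines "q \<equiv> fps_X"
  shows "2 * mex_series (\<lambda>i. 2 * i + 1) distinct_even + partition_series distinct_even
    = partition_series distinct_even * (qpoch_inf (- q) (q\<^sup>2) ^ 2 * qpoch_inf (q\<^sup>2) (q\<^sup>2))"
proof -
  let ?G = "partition_series distinct_even :: 'a fps" and ?p = "\<lambda>i::nat. 2 * i + 1"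
  let ?theta = "qpoch_inf (- q) (q\<^sup>2) ^ 2 * qpoch_inf (q\<^sup>2) (q\<^sup>2)"
  have "strict_mono ?p"
    by (simp add: strict_mono_def)
  from mex_series_sums[OF this, of distinct_even, where 'a = 'a]
  have "(\<lambda>k. q ^ (Suc k)\<^sup>2 * ?G) sums mex_series ?p distinct_even"
    unfolding lessThan_Suc_atMost[symmetric] partition_series_odd_run q_def .
  from sums_mult_fps[OF this, of 2]
  have "(\<lambda>k. ?G * (2 * q ^ (Suc k)\<^sup>2)) sums (2 * mex_series ?p distinct_even)"
    by (simp only: mult_ac)
  moreover have "(\<lambda>k. ?G * (2 * q ^ (Suc k)\<^sup>2)) sums (?G * (?theta - 1))"
    by (intro sums_mult_fps gauss_theta_sums) (simp add: q_def)
  ultimately have "2 * mex_series ?p distinct_even = ?G * (?theta - 1)"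
    by (rule sums_unique2)
  then show ?thesis
    by (simp add: algebra_simps)
qed

lemma mex_series_even:
  fixes q :: "'a::field fps"
  defines "q \<equiv> fps_X"
  shows "mex_series (\<lambda>i. 2 * i + 2) distinct_even + partition_series distinct_even
    = partition_series distinct_even * sigma_series (q\<^sup>2)"
proof -
  let ?G = "partition_series distinct_even :: 'a fps" and ?p = "\<lambda>i::nat. 2 * i + 2"
  let ?t = "\<lambda>k. (q\<^sup>2) ^ (k * (k + 1) div 2) / qpoch (- (q\<^sup>2)) (q\<^sup>2) k"
  have run: "partition_series {M \<in> distinct_even. ?p ` {..<k} \<subseteq> set_mset M} = ?G * ?t k" for k
  proof -
    have unit: "qpoch (- (q\<^sup>2)) (q\<^sup>2) k $ 0 \<noteq> 0"
      by (simp add: qpoch_nth_0 q_def)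
    have "(q\<^sup>2) ^ (k * (k + 1) div 2) = q ^ (k * (k + 1))"
      by (simp flip: power_mult)
    then have "partition_series {M \<in> distinct_even. ?p ` {..<k} \<subseteq> set_mset M}
        = ?G * (q\<^sup>2) ^ (k * (k + 1) div 2) / qpoch (- (q\<^sup>2)) (q\<^sup>2) k"
      using partition_series_even_run[of k, where 'a = 'a]
      by (intro fps_divide_eqI unit) (simp only: q_def mult.commute)
    then show ?thesis
      using unit by (simp add: fps_divide_unit mult.assoc)
  qed
  have "strict_mono ?p"
    by (simp add: strict_mono_def)
  from mex_series_sums[OF this, of distinct_even, where 'a = 'a]
  have "(\<lambda>k. ?G * ?t (Suc k)) sums mex_series ?p distinct_even"
    unfolding lessThan_Suc_atMost[symmetric] run .
  from sums_Suc[OF this] have "(\<lambda>k. ?G * ?t k) sums (mex_series ?p distinct_even + ?G)"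
    by simp
  from sums_mult_fps[OF this, of "inverse ?G"]
  have "?t sums (inverse ?G * (mex_series ?p distinct_even + ?G))"
    by (simp only: mult.assoc[symmetric])
      (simp add: inverse_mult_eq_1 partition_series_distinct_even_nth_0)
  then have "sigma_series (q\<^sup>2) = inverse ?G * (mex_series ?p distinct_even + ?G)"
    unfolding sigma_series_def by (rule sums_unique[symmetric])
  then show ?thesis
    by (simp add: mult.assoc[symmetric] inverse_mult_eq_1' partition_series_distinct_even_nth_0)
qed

lemma sigma_ed_moex_series:
  fixes q :: "'a::field fps"
  defines "q \<equiv> fps_X"
  shows "Abs_fps (\<lambda>n. of_nat (sigma_ed_moex n)) =
    qpoch_inf (q\<^sup>2) (q\<^sup>2) ^ 2 * qpoch_inf (- q) q ^ 3 / qpoch_inf (q ^ 4) (q ^ 4)"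
proof (rule fps_divide_eqI)
  let ?G = "partition_series distinct_even :: 'a fps"
  let ?P = "qpoch_inf (q\<^sup>2) (q\<^sup>2)" and ?E = "qpoch_inf (- (q\<^sup>2)) (q\<^sup>2)"
    and ?D = "qpoch_inf (- q) (q\<^sup>2)"
  have q: "q $ 0 = 0" "q\<^sup>2 $ 0 = 0" "q ^ 4 $ 0 = 0"
    by (simp_all add: q_def)
  have qpoch_neg: "qpoch_inf (- q) q = ?D * ?E"
    using qpoch_inf_even_odd[OF q(1), of "- q"] by (simp add: power2_eq_square)
  have qpoch_four: "qpoch_inf (q ^ 4) (q ^ 4) = ?P * ?E"
    using qpoch_inf_mult_uminus[OF q(2), of "q\<^sup>2"] by simp
  have "?G = ?G * qpoch_inf q (q\<^sup>2) * qpoch_inf (- q) q"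
    using euler_distinct_odd[OF q(1)] by (simp add: mult_ac)
  also have "?G * qpoch_inf q (q\<^sup>2) = ?E"
    unfolding q_def by (rule partition_series_distinct_even)
  finally have "?G = ?E * (?D * ?E)"
    by (simp only: qpoch_neg)
  moreover have "Abs_fps (\<lambda>n. of_nat (sigma_ed_moex n)) = ?G * (?D ^ 2 * ?P)"
    using P_ed_affine_mex_index_series[OF moex_eq, where 'a = 'a] mex_series_odd[where 'a = 'a]
    by (simp add: sigma_ed_moex_def q_def)
  ultimately show "Abs_fps (\<lambda>n. of_nat (sigma_ed_moex n)) * qpoch_inf (q ^ 4) (q ^ 4)
      = ?P ^ 2 * qpoch_inf (- q) q ^ 3"
    unfolding qpoch_four qpoch_neg by (simp add: power2_eq_square power3_eq_cube mult_ac)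
  show "qpoch_inf (q ^ 4) (q ^ 4) $ 0 \<noteq> 0"
    using qpoch_inf_nth_0[OF q(3) q(3)] by simp
qed

lemma sigma_ed_meex_series:
  fixes q :: "'a::field fps"
  defines "q \<equiv> fps_X"
  shows "Abs_fps (\<lambda>n. of_nat (sigma_ed_meex n)) =
    2 * (qpoch_inf (- (q\<^sup>2)) (q\<^sup>2) / qpoch_inf q (q\<^sup>2)) * sigma_series (q\<^sup>2)"
proof -
  let ?G = "partition_series distinct_even :: 'a fps" and ?p = "\<lambda>i::nat. 2 * i + 2"
  have "Abs_fps (\<lambda>n. of_nat (sigma_ed_meex n)) = 2 * (mex_series ?p distinct_even + ?G)"
    using P_ed_affine_mex_index_series[OF meex_eq, where 'a = 'a]
    by (simp add: sigma_ed_meex_def distrib_left)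
  also have "\<dots> = 2 * ?G * sigma_series (q\<^sup>2)"
    unfolding q_def by (simp only: mex_series_even mult.assoc)
  finally show ?thesis
    unfolding q_def partition_series_distinct_even_eq_divide .
qed

theorem theorem1p12:
  fixes q :: "rat fps"
  defines "q \<equiv> fps_X"
  shows "Abs_fps (\<lambda>n. of_nat (sigma_ed_moex n)) =
           qpoch_inf (q\<^sup>2) (q\<^sup>2) ^ 2 * qpoch_inf (- q) q ^ 3 / qpoch_inf (q ^ 4) (q ^ 4) \<and>
         Abs_fps (\<lambda>n. of_nat (sigma_ed_meex n)) =
           2 * (qpoch_inf (- (q\<^sup>2)) (q\<^sup>2) / qpoch_inf q (q\<^sup>2)) * sigma_series (q\<^sup>2)"
  unfolding q_def by (intro conjI sigma_ed_moex_series sigma_ed_meex_series)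

end
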